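(* For each $n\ge1$, the map $\Phi:\operatorname{Sort}_n(\operatorname{SC}_{132})\to\mathbf D_n$ is a bijection. Consequently, $|\operatorname{Sort}_n(\operatorname{SC}_{132})|=C_n=\frac{1}{n+1}\binom{2n}{n}$.
   Context: $S_n$ is the set of permutations of $[n]$ in one-line notation. Two sequences of distinct integers have the same relative order if replacing the $i$th smallest entry of each by $i$ yields the same word; a permutation contains $\sigma$ classically (resp. consecutively) if some subsequence (resp. consecutive subsequence) has the same relative order as $\sigma$, and avoids it otherwise. $\operatorname{SC}_{132}:S_n\to S_n$ sends a permutation through a stack: at each step, if there is a next input entry and placing it on top of the stack would make the stack contents, read top to bottom, avoid $132$ consecutively, push it; otherwise pop the top entry of the stack to the end of the output; stop when the output has length $n$. $\operatorname{Sort}_n(\operatorname{SC}_{132})$ is the set of $\pi\in S_n$ such that $\operatorname{SC}_{132}(\pi)$ avoids $231$ classically. $\mathbf D_n$ is the set of Dyck paths of semilength $n$: words over $\{U,D\}$ with $n$ copies of each letter such that every prefix has at least as many $U$'s as $D$'s. For $\pi\in\operatorname{Sort}_n(\operatorname{SC}_{132})$, write $\pi=a_1\cdots a_k$ where $a_1,\dots,a_k$ are its ascending runs (maximal consecutive increasing subsequences), let $m_i$ be the first entry of $a_i$, set $m_0=n+1$, and define $\Phi(\pi)=U^{m_0-m_1}D^{|a_1|}U^{m_1-m_2}D^{|a_2|}\cdots U^{m_{k-1}-m_k}D^{|a_k|}$. *)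

theory Defs
  imports
    Complex_Main
    "HOL-Library.Sublist"
    "HOL-Combinatorics.Multiset_Permutations"
begin

text \<open>Permutations of \<open>[n]\<close> in one-line notation are the lists in
  \<^term>\<open>permutations_of_set {1..n}\<close>.\<close>

definition standardize :: "nat list \<Rightarrow> nat list" where
  "standardize w = map (\<lambda>x. card {y \<in> set w. y \<le> x}) w"

definition same_relative_order :: "nat list \<Rightarrow> nat list \<Rightarrow> bool" where
  "same_relative_order u v \<longleftrightarrow> standardize u = standardize v"

definition avoids_classically :: "nat list \<Rightarrow> nat list \<Rightarrow> bool" where
  "avoids_classically \<sigma> w \<longleftrightarrow> \<not> (\<exists>u. subseq u w \<and> same_relative_order u \<sigma>)"

definition avoids_consecutively :: "nat list \<Rightarrow> nat list \<Rightarrow> bool" where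
  "avoids_consecutively \<sigma> w \<longleftrightarrow> \<not> (\<exists>u. sublist u w \<and> same_relative_order u \<sigma>)"

text \<open>The arguments are the remaining input, the stack contents read top to bottom, and the
  output so far. In the third equation there is no test, since a one-entry stack always avoids
  132 (lemma \<open>singleton_avoids_132\<close> below).\<close>

fun SC132_run :: "nat list \<Rightarrow> nat list \<Rightarrow> nat list \<Rightarrow> nat list" where
  "SC132_run [] [] out = out"
| "SC132_run [] (t # st) out = SC132_run [] st (out @ [t])"
| "SC132_run (x # xs) [] out = SC132_run xs [x] out"
| "SC132_run (x # xs) (t # st) out =
     (if avoids_consecutively [1, 3, 2] (x # t # st)
      then SC132_run xs (x # t # st) out
      else SC132_run (x # xs) st (out @ [t]))"

lemma singleton_avoids_132: "avoids_consecutively [1, 3, 2] [x]"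
proof -
  have "length u = 3" if "same_relative_order u [1, 3, 2]" for u
    using arg_cong[OF that[unfolded same_relative_order_def], of length]
    by (simp add: standardize_def)
  then show ?thesis
    unfolding avoids_consecutively_def by (auto dest!: sublist_length_le)
qed

definition SC132 :: "nat list \<Rightarrow> nat list" where
  "SC132 \<pi> = SC132_run \<pi> [] []"

definition Sort_SC132 :: "nat \<Rightarrow> nat list set" where
  "Sort_SC132 n = {\<pi> \<in> permutations_of_set {1..n}. avoids_classically [2, 3, 1] (SC132 \<pi>)}"

datatype dyck_step = U | D

definition Dyck_paths :: "nat \<Rightarrow> dyck_step list set" where
  "Dyck_paths n = {w. count_list w U = n \<and> count_list w D = n \<and>
     (\<forall>p. prefix p w \<longrightarrow> count_list p D \<le> count_list p U)}"

fun ascending_runs :: "nat list \<Rightarrow> nat list list" where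
  "ascending_runs [] = []"
| "ascending_runs (x # xs) =
     (case ascending_runs xs of
        [] \<Rightarrow> [[x]]
      | r # rs \<Rightarrow> if x < hd r then (x # r) # rs else [x] # r # rs)"

text \<open>\<^term>\<open>Phi_word m [a\<^sub>1, a\<^sub>2]\<close> is the word
  \<open>U\<^bsup>m - m\<^sub>1\<^esup> D\<^bsup>|a\<^sub>1|\<^esup> U\<^bsup>m\<^sub>1 - m\<^sub>2\<^esup> D\<^bsup>|a\<^sub>2|\<^esup>\<close>, with \<open>m\<^sub>i\<close> the first entry of \<open>a\<^sub>i\<close>, and
  similarly for longer lists. The subtraction is on \<^typ>\<open>nat\<close>, so this is the intended word only
  when \<open>m \<ge> m\<^sub>1 \<ge> m\<^sub>2 \<ge> \<dots>\<close>; this is what \<open>Phi_exponents_nonneg\<close> says.\<close>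

fun Phi_word :: "nat \<Rightarrow> nat list list \<Rightarrow> dyck_step list" where
  "Phi_word m [] = []"
| "Phi_word m (a # as) = replicate (m - hd a) U @ replicate (length a) D @ Phi_word (hd a) as"

definition Phi :: "nat \<Rightarrow> nat list \<Rightarrow> dyck_step list" where
  "Phi n \<pi> = Phi_word (n + 1) (ascending_runs \<pi>)"

definition Phi_exponents_nonneg :: "nat \<Rightarrow> nat list \<Rightarrow> bool" where
  "Phi_exponents_nonneg n \<pi> \<longleftrightarrow> successively (\<ge>) ((n + 1) # map hd (ascending_runs \<pi>))"

end

theory Submission
  imports Defs
begin

text \<open>
  Let \<open>\<pi>\<close> have ascending runs \<open>h\<^sub>i t\<^sub>i\<close> with heads \<open>h\<^sub>i\<close> and tails \<open>t\<^sub>i\<close>. Then \<open>\<pi>\<close> is sortable iff the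
  heads decrease and every entry of a tail exceeds all entries of later tails. As long as the input
  read so far has this form, the stack consists of the current tail on top of the heads seen so
  far, and the earlier tails have been output in decreasing order; the final output is then
  decreasing followed by increasing and avoids 231. The first violation creates a 231 in the
  output, because the output so far followed by the stack is always a subsequence of the final
  output.

  Such a permutation is determined by its heads and run lengths: label the up steps of the path
  \<open>n, \<dots>, 1\<close>; the labels at peaks are the heads, the others wait in a queue from which the tails
  are served. The queue length is governed by the height of the path, so the Dyck condition says
  exactly that the queue never runs out.
\<close>

subsection \<open>Sortable permutations\<close>

lemma standardize_eq_iff_length3:
  "standardize u = [i, j, k] \<longleftrightarrow> (\<exists>a b c. u = [a, b, c] \<and> card {y \<in> {a, b, c}. y \<le> a} = i \<and>
    card {y \<in> {a, b, c}. y \<le> b} = j \<and> card {y \<in> {a, b, c}. y \<le> c} = k)"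
  by (auto simp: standardize_def map_eq_Cons_conv)

lemma Collect_le_insert:
  "{y \<in> insert a A. y \<le> (x::nat)} = (if a \<le> x then insert a {y \<in> A. y \<le> x} else {y \<in> A. y \<le> x})"
  by auto

lemma same_relative_order_132_iff:
  "same_relative_order u [1, 3, 2] \<longleftrightarrow> (\<exists>a b c. u = [a, b, c] \<and> a < c \<and> c < b)"
proof -
  have *: "standardize [1, 3, 2] = [1, 3, 2]"
    unfolding standardize_def list.map list.set Collect_le_insert by simp
  show ?thesis
    unfolding same_relative_order_def * standardize_eq_iff_length3 Collect_le_insert
    by ((rule ex_cong1)+, rule conj_cong[OF refl]) (auto simp: card_insert_if split: if_splits)
qed

lemma same_relative_order_231_iff:
  "same_relative_order u [2, 3, 1] \<longleftrightarrow> (\<exists>a b c. u = [a, b, c] \<and> c < a \<and> a < b)"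
proof -
  have *: "standardize [2, 3, 1] = [2, 3, 1]"
    unfolding standardize_def list.map list.set Collect_le_insert by simp
  show ?thesis
    unfolding same_relative_order_def * standardize_eq_iff_length3 Collect_le_insert
    by ((rule ex_cong1)+, rule conj_cong[OF refl]) (auto simp: card_insert_if split: if_splits)
qed

lemma avoids_classically_231_iff:
  "avoids_classically [2, 3, 1] w \<longleftrightarrow> (\<forall>a b c. subseq [a, b, c] w \<longrightarrow> \<not> (c < a \<and> a < b))"
  unfolding avoids_classically_def same_relative_order_231_iff by blast

lemma avoids_consecutively_132_iff:
  "avoids_consecutively [1, 3, 2] w \<longleftrightarrow> (\<forall>a b c. sublist [a, b, c] w \<longrightarrow> \<not> (a < c \<and> c < b))"
  unfolding avoids_consecutively_def same_relative_order_132_iff by blast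

text \<open>The pattern is spelled with \<open>Suc 0\<close> because the simplifier rewrites
  \<open>1\<close> to this form before the equations are matched.\<close>

lemma avoids_consecutively_132_simps:
  "avoids_consecutively [Suc 0, 3, 2] [x]"
  "avoids_consecutively [Suc 0, 3, 2] [x, t]"
  "avoids_consecutively [Suc 0, 3, 2] (x # t # s # st) \<longleftrightarrow>
     \<not> (x < s \<and> s < t) \<and> avoids_consecutively [Suc 0, 3, 2] (t # s # st)"
  unfolding One_nat_def[symmetric] avoids_consecutively_132_iff by (auto simp: sublist_Cons_right)

text \<open>The middle entry of a consecutive 132 is a peak, and a decreasing word continued by an
  increasing one has no interior peak.\<close>

lemma valley_avoids_132:
  assumes "sorted_wrt (>) (ts @ [h])" "sorted_wrt (<) (h # hs)"
  shows "avoids_consecutively [1, 3, 2] (ts @ h # hs)"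
  using assms
proof (induction ts)
  case Nil
  then show ?case
  proof (induction hs arbitrary: h)
    case (Cons a hs)
    then show ?case by (cases hs) (auto simp: avoids_consecutively_132_simps)
  qed (simp add: avoids_consecutively_132_simps)
next
  case (Cons t ts)
  show ?case
  proof (cases ts)
    case Nil
    then show ?thesis using Cons
      by (cases hs) (auto simp: avoids_consecutively_132_simps)
  next
    case (Cons t' ts')
    then show ?thesis using Cons.IH Cons.prems
      by (cases "ts' @ h # hs") (auto simp: avoids_consecutively_132_simps)
  qed
qed

lemma sorted_wrt_subseq: "subseq xs ys \<Longrightarrow> sorted_wrt R ys \<Longrightarrow> sorted_wrt R xs"
  by (induction rule: list_emb.induct) (auto dest: list_emb_set)

text \<open>If \<open>a < b\<close> and \<open>a\<close> lies in the decreasing part, then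
  \<open>b\<close> lies in the increasing part, so everything after \<open>b\<close> is larger than
  \<open>b\<close>.\<close>

lemma valley_avoids_231:
  assumes "sorted_wrt (>) ds" "sorted_wrt (<) is"
  shows "avoids_classically [2, 3, 1] (ds @ is)"
  unfolding avoids_classically_231_iff
proof (intro allI impI)
  fix a b c assume "subseq [a, b, c] (ds @ is)"
  with assms(1) show "\<not> (c < a \<and> a < b)"
  proof (induction ds)
    case Nil
    then have "sorted_wrt (<) [a, b, c]"
      using assms(2) by (metis append_Nil sorted_wrt_subseq)
    then show ?case by auto
  next
    case (Cons d ds)
    show ?case
    proof
      assume *: "c < a \<and> a < b"
      with Cons have "a = d" "subseq [b, c] (ds @ is)"
        by (auto split: if_splits)
      moreover have "subseq [b, c] is" if "subseq [b, c] (ds @ is)" "b \<notin> set ds" for ds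
        using that by (induction ds) auto
      ultimately have "subseq [b, c] is"
        using Cons.prems(1) * by force
      then have "sorted_wrt (<) [b, c]"
        using assms(2) sorted_wrt_subseq by blast
      with * show False by simp
    qed
  qed
qed

section \<open>Behaviour of the stack on increasing, minimal and interleaved entries\<close>

text \<open>A pop leaves the word \<open>out @ st\<close> unchanged and a push inserts one letter
  into it. Hence a 231 that appears in this word at any moment survives in the final output.\<close>

lemma subseq_SC132_run: "subseq (out @ st) (SC132_run xs st out)"
proof (induction xs st out rule: SC132_run.induct)
  case (3 x xs out)
  then show ?case by (auto dest: subseq_order.trans[rotated] intro: list_emb_append_mono)
next
  case (4 x xs t st out)
  have "subseq (out @ t # st) (out @ x # t # st)"
    by (intro list_emb_append_mono) auto
  with 4 show ?case by (auto intro: subseq_order.trans)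
qed auto

lemma SC132_run_no_input: "SC132_run [] st out = out @ st"
  by (induction st arbitrary: out) auto

text \<open>A push can create a 132 only with the new entry in the role of 1, which is impossible if
  it exceeds the old top.\<close>

lemma SC132_run_push_increasing:
  assumes "sorted_wrt (<) (t # a)" "avoids_consecutively [1, 3, 2] (t # st)"
  shows "SC132_run (a @ xs) (t # st) out = SC132_run xs (rev a @ t # st) out"
  using assms
proof (induction a arbitrary: t st)
  case (Cons x a)
  then have "avoids_consecutively [1, 3, 2] (x # t # st)"
    by (cases st) (auto simp: avoids_consecutively_132_simps)
  with Cons show ?case by simp
qed simp

text \<open>While some \<open>t\<close> lies above \<open>h\<close>, the entry \<open>s\<close>
  under it satisfies \<open>x < s < t\<close>, so \<open>t\<close> is popped. Once \<open>h\<close>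
  is on top, pushing \<open>x\<close> makes the stack increasing.\<close>

lemma SC132_run_new_minimum:
  assumes "sorted_wrt (>) (ts @ [h])" "sorted_wrt (<) (h # hs)" "x < h"
  shows "SC132_run (x # xs) (ts @ h # hs) out = SC132_run xs (x # h # hs) (out @ ts)"
  using assms
proof (induction ts arbitrary: out)
  case Nil
  then have "avoids_consecutively [1, 3, 2] (x # h # hs)"
    using valley_avoids_132[of "[]" x "h # hs"] by fastforce
  then show ?case by simp
next
  case (Cons t ts)
  have "\<not> avoids_consecutively [1, 3, 2] (x # t # ts @ h # hs)"
    using Cons.prems by (cases ts) (auto simp: avoids_consecutively_132_simps)
  with Cons show ?case by simp
qed

text \<open>If the next entry lies strictly between the bottom and the top of the decreasing part of the
  stack, popping stops at consecutive stack entries around it, and these give the pattern.\<close>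

lemma SC132_run_interleaved_contains_231:
  assumes "sorted_wrt (>) (t # ts @ [h])" "sorted_wrt (<) (h # hs)" "h < x" "x < t" "x \<notin> set ts"
  shows "\<not> avoids_classically [2, 3, 1] (SC132_run (x # xs) (t # ts @ h # hs) out)"
  using assms
proof (induction ts arbitrary: t out)
  case Nil
  \<comment> \<open>Since \<open>h < x\<close>, the entry \<open>x\<close> is pushed onto
    \<open>t\<close>, and \<open>x, t, h\<close> is the 231.\<close>
  have "avoids_consecutively [1, 3, 2] (x # t # h # hs)"
    using valley_avoids_132[of "[t]" h hs] Nil by (auto simp: avoids_consecutively_132_simps)
  then have "subseq (out @ x # t # h # hs) (SC132_run (x # xs) (t # h # hs) out)"
    using subseq_SC132_run[of out "x # t # h # hs" xs] by simp
  moreover have "subseq [x, t, h] (out @ x # t # h # hs)"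
    by (rule list_emb_append2) simp
  ultimately have "subseq [x, t, h] (SC132_run (x # xs) (t # h # hs) out)"
    using subseq_order.trans by blast
  then show ?case
    using \<open>h < x\<close> \<open>x < t\<close> unfolding append_Nil avoids_classically_231_iff by blast
next
  case (Cons s ts)
  show ?case
  proof (cases "x < s")
    case True
    then have "\<not> avoids_consecutively [1, 3, 2] (x # t # s # ts @ h # hs)"
      using Cons.prems by (auto simp: avoids_consecutively_132_simps)
    with Cons True show ?thesis by simp
  next
    case False
    with Cons.prems have "s < x" by auto
    then have "avoids_consecutively [1, 3, 2] (x # t # s # ts @ h # hs)"
      using valley_avoids_132[of "t # s # ts" h hs] Cons.prems
      by (auto simp: avoids_consecutively_132_simps)
    then have "subseq (out @ x # t # s # ts @ h # hs)
        (SC132_run (x # xs) (t # s # ts @ h # hs) out)"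
      using subseq_SC132_run[of out "x # t # s # ts @ h # hs" xs] by simp
    moreover have "subseq [x, t, s] (out @ x # t # s # ts @ h # hs)"
      by (rule list_emb_append2) simp
    ultimately have "subseq [x, t, s] (SC132_run (x # xs) (t # s # ts @ h # hs) out)"
      using subseq_order.trans by blast
    then show ?thesis
      using \<open>s < x\<close> \<open>x < t\<close> unfolding append_Cons avoids_classically_231_iff by blast
  qed
qed

text \<open>An empty tail satisfies the second condition vacuously, so the relation is not
  transitive. It is therefore imposed on all pairs of runs by \<open>sorted_wrt\<close>, not only on
  neighbours.\<close>

definition layered :: "nat list \<Rightarrow> nat list \<Rightarrow> bool" where
  "layered a b \<longleftrightarrow> hd b < hd a \<and> (\<forall>x \<in> set (tl a). \<forall>y \<in> set (tl b). y < x)"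

abbreviation increasing_run :: "nat list \<Rightarrow> bool" where
  "increasing_run a \<equiv> a \<noteq> [] \<and> sorted_wrt (<) a"

text \<open>Each new head is a new minimum: it expels the current tail, which leaves in decreasing
  order, and stays on the stack under its own tail.\<close>

lemma SC132_run_layered:
  assumes "sorted_wrt layered ((h # t) # rs)" "\<forall>a \<in> set ((h # t) # rs). increasing_run a"
    "sorted_wrt (<) (h # hs)"
  shows "SC132_run (concat rs) (rev t @ h # hs) out =
    out @ concat (map (rev \<circ> tl) ((h # t) # rs)) @ rev (map hd rs) @ h # hs"
  using assms
proof (induction rs arbitrary: h t hs out)
  case Nil
  then show ?case by (simp add: SC132_run_no_input)
next
  case (Cons r rs)
  then obtain x a where r: "r = x # a" by (cases r) auto
  have "x < h" using Cons.prems r by (auto simp: layered_def)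
  have "SC132_run (concat (r # rs)) (rev t @ h # hs) out =
      SC132_run (a @ concat rs) (x # h # hs) (out @ rev t)"
    using SC132_run_new_minimum[of "rev t" h hs x] Cons.prems \<open>x < h\<close>
    by (simp add: r sorted_wrt_append sorted_wrt_rev)
  also have "\<dots> = SC132_run (concat rs) (rev a @ x # h # hs) (out @ rev t)"
  proof (rule SC132_run_push_increasing)
    show "avoids_consecutively [1, 3, 2] (x # h # hs)"
      using valley_avoids_132[of "[]" x "h # hs"] Cons.prems \<open>x < h\<close> by fastforce
  qed (use Cons.prems r in auto)
  also have "\<dots> = out @ rev t @ concat (map (rev \<circ> tl) ((x # a) # rs)) @
      rev (map hd rs) @ x # h # hs"
    using Cons.IH[of x a "h # hs" "out @ rev t"] Cons.prems \<open>x < h\<close>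
    by (fastforce simp: r comp_def)
  finally show ?case by (simp add: r comp_def)
qed

text \<open>The induction has to remember the expelled tails, hence the extra conclusion about
  \<open>out\<close>. The hypothesis \<open>h < y\<close> for output entries \<open>y\<close> lets
  every later head serve as the 1 of a 231.\<close>

lemma layered_if_SC132_run_avoids_231:
  assumes "avoids_classically [2, 3, 1] (SC132_run (concat rs) (rev t @ h # hs) out)"
    "\<forall>a \<in> set ((h # t) # rs). increasing_run a"
    "successively (\<lambda>a b. hd b < last a) ((h # t) # rs)"
    "sorted_wrt (<) (h # hs)" "\<forall>y \<in> set out. h < y"
    "distinct (out @ concat ((h # t) # rs))"
  shows "sorted_wrt layered ((h # t) # rs) \<and> (\<forall>r \<in> set rs. \<forall>x \<in> set (tl r). \<forall>y \<in> set out. x < y)"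
  using assms
proof (induction rs arbitrary: h t hs out)
  case Nil
  then show ?case by simp
next
  case (Cons r rs)
  then obtain x a where r: "r = x # a" by (cases r) auto
  have t: "sorted_wrt (>) (rev t @ [h])"
    using Cons.prems by (simp add: sorted_wrt_append sorted_wrt_rev)
  \<comment> \<open>Otherwise \<open>x\<close> exceeds \<open>h\<close> but not the end of the run
    \<open>h # t\<close>, so it falls strictly between the bottom and the top of the decreasing part
    of the stack.\<close>
  have "x < h"
  proof (rule ccontr)
    assume "\<not> x < h"
    with Cons.prems r have "h < x" by auto
    moreover have "x < last (h # t)" using Cons.prems r by simp
    ultimately obtain t' z where tz: "t = t' @ [z]" and "x < z"
      by (cases t rule: rev_cases) auto
    then have "\<not> avoids_classically [2, 3, 1]
        (SC132_run (x # a @ concat rs) (z # rev t' @ h # hs) out)"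
      using SC132_run_interleaved_contains_231[of z "rev t'" h hs x] t Cons.prems \<open>h < x\<close> r
      by auto
    then show False using Cons.prems by (simp add: r tz)
  qed
  have "SC132_run (concat (r # rs)) (rev t @ h # hs) out =
      SC132_run (a @ concat rs) (x # h # hs) (out @ rev t)"
    using SC132_run_new_minimum[OF t, of hs x] Cons.prems \<open>x < h\<close> by (simp add: r)
  also have "\<dots> = SC132_run (concat rs) (rev a @ x # h # hs) (out @ rev t)"
  proof (rule SC132_run_push_increasing)
    show "avoids_consecutively [1, 3, 2] (x # h # hs)"
      using valley_avoids_132[of "[]" x "h # hs"] Cons.prems \<open>x < h\<close> by fastforce
  qed (use Cons.prems r in auto)
  finally have run: "SC132_run (concat (r # rs)) (rev t @ h # hs) out =
      SC132_run (concat rs) (rev a @ x # h # hs) (out @ rev t)" .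
  \<comment> \<open>With \<open>rev t\<close> counted as output, the induction hypothesis compares
    \<open>t\<close> with all later tails except \<open>a\<close>, which is treated next.\<close>
  have "sorted_wrt layered ((x # a) # rs) \<and>
    (\<forall>r \<in> set rs. \<forall>x \<in> set (tl r). \<forall>y \<in> set (out @ rev t). x < y)"
  proof (rule Cons.IH)
    show "avoids_classically [2, 3, 1]
        (SC132_run (concat rs) (rev a @ x # h # hs) (out @ rev t))"
      using Cons.prems(1) unfolding run .
    show "\<forall>a \<in> set ((x # a) # rs). increasing_run a"
      "successively (\<lambda>a b. hd b < last a) ((x # a) # rs)"
      using Cons.prems(2,3) by (simp_all add: r)
    show "sorted_wrt (<) (x # h # hs)" using Cons.prems(4) \<open>x < h\<close> by auto
    show "\<forall>y \<in> set (out @ rev t). x < y" using Cons.prems(2,5) \<open>x < h\<close> by auto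
    show "distinct ((out @ rev t) @ concat ((x # a) # rs))" using Cons.prems(6) by (auto simp: r)
  qed
  then have IH: "sorted_wrt layered ((x # a) # rs)"
    "\<And>r x y. r \<in> set rs \<Longrightarrow> x \<in> set (tl r) \<Longrightarrow> y \<in> set (out @ rev t) \<Longrightarrow> x < y"
    by blast+
  \<comment> \<open>If \<open>y < z\<close>, then \<open>y, z, x\<close> is a 231: \<open>y\<close>
    is already output, and \<open>z\<close> lies above \<open>x\<close> on the stack.\<close>
  have a: "z < y" if "z \<in> set a" "y \<in> set (out @ t)" for y z
  proof (rule ccontr)
    assume "\<not> z < y"
    with that Cons.prems r have "y < z" by (auto simp: not_less le_less)
    have "subseq [y] (out @ rev t)" "subseq [z] (rev a)"
      using that by (auto simp: subseq_singleton_left)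
    then have "subseq ([y] @ [z] @ [x]) ((out @ rev t) @ rev a @ x # h # hs)"
      by (intro list_emb_append_mono) auto
    then have "subseq [y, z, x] (SC132_run (concat (r # rs)) (rev t @ h # hs) out)"
      unfolding run append_Cons append_Nil by (rule subseq_order.trans[OF _ subseq_SC132_run])
    moreover have "x < y" using that Cons.prems \<open>x < h\<close> by auto
    ultimately show False
      using Cons.prems(1) \<open>y < z\<close> unfolding avoids_classically_231_iff by blast
  qed
  have "layered (h # t) b" if "b \<in> set ((x # a) # rs)" for b
    using that IH a \<open>x < h\<close> by (auto simp: layered_def)
  then show ?case using IH a by (auto simp: r)
qed

section \<open>Ascending runs and the characterisation of sortability\<close>

lemma concat_ascending_runs: "concat (ascending_runs xs) = xs"
  by (induction xs) (auto split: list.split)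

lemma increasing_run_ascending_runs: "\<forall>a \<in> set (ascending_runs xs). increasing_run a"
proof (induction xs)
  case (Cons x xs)
  show ?case
  proof (cases "ascending_runs xs")
    case (Cons r rs)
    with Cons.IH show ?thesis by (cases r) auto
  qed simp
qed simp

text \<open>A run is closed when \<open>x < hd r\<close> fails; distinctness turns this into a
  strict descent.\<close>

lemma successively_ascending_runs:
  assumes "distinct xs"
  shows "successively (\<lambda>a b. hd b < last a) (ascending_runs xs)"
  using assms
proof (induction xs)
  case (Cons x xs)
  show ?case
  proof (cases "ascending_runs xs")
    case rs: (Cons r rs)
    then have r: "r \<noteq> []"
      using increasing_run_ascending_runs[of xs] by auto
    then have "hd r \<in> set xs"
      using concat_ascending_runs[of xs] rs by (metis concat.simps(2) hd_append2 hd_in_set append_is_Nil_conv)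
    with Cons.prems have "hd r \<noteq> x" by auto
    with Cons rs r show ?thesis by (cases rs) auto
  qed simp
qed simp

lemma ascending_runs_concat_layered:
  assumes "sorted_wrt layered rs" "\<forall>a \<in> set rs. increasing_run a"
  shows "ascending_runs (concat rs) = rs"
  using assms
proof (induction rs)
  case (Cons r rs)
  then have IH: "ascending_runs (concat rs) = rs" by simp
  \<comment> \<open>Stated for arbitrary \<open>a\<close>, because the induction strips entries from
    the front of the run; this only raises \<open>hd a\<close>.\<close>
  have "ascending_runs (a @ concat rs) = a # rs"
    if "increasing_run a" "\<forall>b \<in> set rs. hd b < hd a" for a
    using that
  proof (induction a)
    case (Cons x a)
    show ?case
    proof (cases a)
      case Nil
      with Cons.prems IH show ?thesis
        by (auto split: list.split)
    next
      case (Cons y b)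
      then show ?thesis using Cons.IH Cons.prems by fastforce
    qed
  qed simp
  then show ?case using Cons by (auto simp: layered_def)
qed simp

lemma layered_tails_decreasing:
  assumes "sorted_wrt layered rs" "\<forall>a \<in> set rs. increasing_run a"
  shows "sorted_wrt (>) (concat (map (rev \<circ> tl) rs))"
  using assms
proof (induction rs)
  case (Cons r rs)
  have "sorted_wrt (<) (tl r)"
    using Cons.prems by (cases r) auto
  moreover have "y < x" if "x \<in> set (tl r)" "b \<in> set rs" "y \<in> set (tl b)" for x y b
    using Cons.prems(1) that by (auto simp: layered_def)
  ultimately show ?case
    using Cons by (auto simp: sorted_wrt_append sorted_wrt_rev)
qed simp

lemma layered_heads_increasing:
  assumes "sorted_wrt layered rs"
  shows "sorted_wrt (<) (rev (map hd rs))"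
  unfolding sorted_wrt_rev sorted_wrt_map
  by (rule sorted_wrt_mono_rel[OF _ assms]) (simp add: layered_def)

text \<open>The first run is pushed without any pop, so both analyses of \<open>SC132_run\<close>
  start from the stack \<open>rev t @ [h]\<close> and empty output.\<close>

lemma SC132_avoids_231_iff_layered:
  assumes "distinct \<pi>"
  shows "avoids_classically [2, 3, 1] (SC132 \<pi>) \<longleftrightarrow> sorted_wrt layered (ascending_runs \<pi>)"
proof (cases "ascending_runs \<pi>")
  case Nil
  then have "\<pi> = []" using concat_ascending_runs[of \<pi>] by simp
  then show ?thesis
    unfolding avoids_classically_231_iff by (simp add: SC132_def)
next
  case (Cons r rs)
  have inc: "\<forall>a \<in> set (r # rs). increasing_run a"
    using increasing_run_ascending_runs[of \<pi>] Cons by simp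
  then obtain h t where r: "r = h # t" by (cases r) auto
  have \<pi>: "\<pi> = h # t @ concat rs" using concat_ascending_runs[of \<pi>] Cons r by simp
  have dist: "distinct (concat (r # rs))" using assms \<pi> r by simp
  have run: "SC132 \<pi> = SC132_run (concat rs) (rev t @ [h]) []"
    unfolding SC132_def \<pi> using inc r
    using SC132_run_push_increasing[OF _ singleton_avoids_132, of h t "concat rs"] by simp
  show ?thesis
  proof
    assume "avoids_classically [2, 3, 1] (SC132 \<pi>)"
    then show "sorted_wrt layered (ascending_runs \<pi>)"
      using layered_if_SC132_run_avoids_231[of rs t h "[]" "[]"] inc
        successively_ascending_runs[OF assms] dist
      unfolding run Cons r by simp
  next
    assume *: "sorted_wrt layered (ascending_runs \<pi>)"
    then have "SC132 \<pi> = concat (map (rev \<circ> tl) (ascending_runs \<pi>)) @ rev (map hd (ascending_runs \<pi>))"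
      using SC132_run_layered[of h t rs "[]" "[]"] inc unfolding run Cons r by simp
    then show "avoids_classically [2, 3, 1] (SC132 \<pi>)"
      using valley_avoids_231 layered_tails_decreasing[OF *] layered_heads_increasing[OF *]
        increasing_run_ascending_runs by metis
  qed
qed

subsection \<open>Dyck paths as queue processes\<close>

text \<open>Labels \<open>c, \<dots>, 1\<close> are still to be placed, in this order; a label becomes the head of a run or
  joins the end of the queue \<open>q\<close> of entries that still have to occur inside runs. The tail of a
  new run is a reversed initial segment of the queue.\<close>

inductive queue_runs :: "nat \<Rightarrow> nat list \<Rightarrow> nat list list \<Rightarrow> bool" where
  empty: "queue_runs 0 [] []"
| head: "queue_runs c q2 rs \<Longrightarrow> queue_runs (Suc c) (q1 @ q2) ((Suc c # rev q1) # rs)"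
| enqueue: "queue_runs c (q @ [Suc c]) rs \<Longrightarrow> queue_runs (Suc c) q rs"

text \<open>The image of \<open>queue_runs\<close> under \<open>Phi_word\<close>: paths from height \<open>l\<close> down to 0 with \<open>c\<close> up steps
  that do not start with a down step.\<close>

inductive queue_path :: "nat \<Rightarrow> nat \<Rightarrow> dyck_step list \<Rightarrow> bool" where
  empty: "queue_path 0 0 []"
| head: "queue_path c l w \<Longrightarrow> queue_path (Suc c) (k + l) (U # replicate (Suc k) D @ w)"
| enqueue: "queue_path c (Suc l) w \<Longrightarrow> queue_path (Suc c) l (U # w)"

inductive_cases queue_runs_0E: "queue_runs 0 q rs"
inductive_cases queue_runs_SucE: "queue_runs (Suc c) q rs"

lemma queue_runs_heads_le: "queue_runs c q rs \<Longrightarrow> r \<in> set rs \<Longrightarrow> r \<noteq> [] \<and> hd r \<le> c"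
  by (induction rule: queue_runs.induct) fastforce+

lemma queue_runs_Nil: "queue_runs c q [] \<Longrightarrow> c = 0 \<and> q = []"
  by (induction c q "[] :: nat list list" rule: queue_runs.induct) auto

lemma queue_path_Nil_or_U: "queue_path c l w \<Longrightarrow> (w = [] \<and> c = 0 \<and> l = 0) \<or> (w \<noteq> [] \<and> hd w = U)"
  by (induction rule: queue_path.induct) auto

text \<open>Enqueueing a label keeps the runs and raises only the starting value. As
  \<open>rs\<close> is nonempty with heads at most \<open>c\<close>, the subtraction is not
  truncated and the first exponent grows by one.\<close>

lemma Phi_word_Suc:
  assumes "queue_runs c (q @ [x]) rs"
  shows "Phi_word (Suc (Suc c)) rs = U # Phi_word (Suc c) rs"
proof (cases rs)
  case Nil
  then show ?thesis using assms queue_runs_Nil by blast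
next
  case (Cons r rs')
  then have "hd r \<le> c" using queue_runs_heads_le[OF assms] by simp
  then show ?thesis using Cons by (simp add: Suc_diff_le)
qed

text \<open>A head whose tail is \<open>rev q1\<close> gives one \<open>U\<close> and
  \<open>length q1 + 1\<close> letters \<open>D\<close>; an enqueued label gives a single
  \<open>U\<close>. So the height is the queue length.\<close>

lemma queue_path_Phi_word: "queue_runs c q rs \<Longrightarrow> queue_path c (length q) (Phi_word (Suc c) rs)"
proof (induction rule: queue_runs.induct)
  case (head c q2 rs q1)
  then show ?case using queue_path.head[of c "length q2" _ "length q1"] by simp
next
  case (enqueue c q rs)
  then show ?case using queue_path.enqueue[of c "length q"] Phi_word_Suc by simp
qed (simp add: queue_path.empty)

lemma Phi_word_surj:
  "queue_path c l w \<Longrightarrow> length q = l \<Longrightarrow> \<exists>rs. queue_runs c q rs \<and> Phi_word (Suc c) rs = w"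
proof (induction arbitrary: q rule: queue_path.induct)
  case empty
  then show ?case using queue_runs.empty by force
next
  case (head c l w k)
  \<comment> \<open>Of the \<open>k + 1\<close> down steps one belongs to the head, so
    \<open>k\<close> entries are served from the queue.\<close>
  then obtain rs where "queue_runs c (drop k q) rs" "Phi_word (Suc c) rs = w"
    by (metis add_diff_cancel_left' length_drop)
  moreover from this have "queue_runs (Suc c) q ((Suc c # rev (take k q)) # rs)"
    using queue_runs.head[of c "drop k q" rs "take k q"] by simp
  ultimately show ?case using head.prems
    by (intro exI[of _ "(Suc c # rev (take k q)) # rs"]) simp
next
  case (enqueue c l w)
  then obtain rs where "queue_runs c (q @ [Suc c]) rs" "Phi_word (Suc c) rs = w"
    by (metis length_append_singleton)
  then show ?case using queue_runs.enqueue Phi_word_Suc by metis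
qed

lemma replicate_D_append_inject:
  assumes "replicate k D @ v = replicate l D @ w" "v = [] \<or> hd v = U" "w = [] \<or> hd w = U"
  shows "k = l \<and> v = w"
  using assms
proof (induction k arbitrary: l)
  case 0
  then show ?case by (cases l) auto
next
  case (Suc k)
  then show ?case by (cases l) auto
qed

text \<open>The letter after the first \<open>U\<close> tells whether the label \<open>c\<close>
  became a head (\<open>D\<close>) or was enqueued (\<open>U\<close>), where \<open>c\<close> stands
  for the current label. For a head, the length of the maximal block of \<open>D\<close> fixes how
  the known queue is split.\<close>

lemma Phi_word_inj:
  "queue_runs c q rs \<Longrightarrow> queue_runs c q rs' \<Longrightarrow> Phi_word (Suc c) rs = Phi_word (Suc c) rs' \<Longrightarrow> rs = rs'"
proof (induction arbitrary: rs' rule: queue_runs.induct)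
  case empty
  then show ?case by (auto elim: queue_runs_0E)
next
  case (head c q2 rs q1)
  note U1 = queue_path_Nil_or_U[OF queue_path_Phi_word[OF head.hyps]]
  from head.prems(1) consider q1' q2' rs'' where "q1 @ q2 = q1' @ q2'"
      "rs' = (Suc c # rev q1') # rs''" "queue_runs c q2' rs''"
    | "queue_runs c ((q1 @ q2) @ [Suc c]) rs'"
    by (auto elim: queue_runs_SucE)
  then show ?case
  proof cases
    case 1
    note U2 = queue_path_Nil_or_U[OF queue_path_Phi_word[OF 1(3)]]
    have "length q1 = length q1' \<and> Phi_word (Suc c) rs = Phi_word (Suc c) rs''"
      using head.prems(2) U1 U2 unfolding 1
      by (intro replicate_D_append_inject) auto
    with 1 head.IH show ?thesis by auto
  next
    case 2
    then have "Phi_word (Suc (Suc c)) rs' = U # Phi_word (Suc c) rs'"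
      by (rule Phi_word_Suc)
    moreover have "hd (Phi_word (Suc c) rs') = U"
      using queue_path_Nil_or_U[OF queue_path_Phi_word[OF 2]] by simp
    ultimately show ?thesis using head.prems(2)
      by (auto dest!: arg_cong[of _ "Phi_word (Suc c) rs'" hd])
  qed
next
  case (enqueue c q rs)
  note * = Phi_word_Suc[OF enqueue.hyps]
  from enqueue.prems(1) consider q1' q2' rs'' where "q = q1' @ q2'"
      "rs' = (Suc c # rev q1') # rs''" "queue_runs c q2' rs''"
    | "queue_runs c (q @ [Suc c]) rs'"
    by (auto elim: queue_runs_SucE)
  then show ?case
  proof cases
    case 1
    have "hd (Phi_word (Suc c) rs) = U"
      using queue_path_Nil_or_U[OF queue_path_Phi_word[OF enqueue.hyps]] by simp
    then show ?thesis using enqueue.prems(2) * by (auto simp: 1)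
  next
    case 2
    then show ?thesis using enqueue * Phi_word_Suc[OF 2] by simp
  qed
qed

section \<open>Queue paths and the prefix condition\<close>

lemma count_list_replicate: "count_list (replicate k x) y = (if x = y then k else 0)"
  by (induction k) auto

lemma Dyck_suffix_if_queue_path:
  assumes "queue_path c l w"
  shows "count_list w U = c \<and> count_list w D = c + l \<and>
    (\<forall>p. prefix p w \<longrightarrow> count_list p D \<le> l + count_list p U)"
  using assms
proof (induction rule: queue_path.induct)
  case (head c l w k)
  have "count_list p D \<le> k + l + count_list p U" if p: "prefix p (U # replicate (Suc k) D @ w)" for p
  proof (cases p)
    case (Cons x p')
    with p have "x = U" "prefix p' (replicate (Suc k) D @ w)" by auto
    from this(2) consider "prefix p' (replicate (Suc k) D)"
      | p'' where "p' = replicate (Suc k) D @ p''" "prefix p'' w"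
      by (auto simp: prefix_append simp del: replicate_Suc)
    then show ?thesis
    proof cases
      case 1
      then have "length p' \<le> Suc k" using prefix_length_le by fastforce
      then have "count_list p' D \<le> Suc k" using count_le_length[of p' D] by linarith
      then show ?thesis by (simp add: Cons \<open>x = U\<close>)
    next
      case 2
      then have "count_list p'' D \<le> l + count_list p'' U" using head by simp
      then show ?thesis by (simp add: Cons \<open>x = U\<close> 2 count_list_append count_list_replicate)
    qed
  qed simp
  with head show ?case by (simp add: count_list_append count_list_replicate)
next
  case (enqueue c l w)
  then show ?case by (auto simp: prefix_Cons)
qed simp

lemma count_list_U_0: "count_list w U = 0 \<Longrightarrow> w = [] \<or> hd w = U \<Longrightarrow> w = []"
  by (cases w) auto

text \<open>After the first \<open>U\<close>, either the remainder can again play the role of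
  \<open>w\<close>, or the maximal block of \<open>D\<close> that follows is split off as a
  peak.\<close>

lemma queue_path_if_Dyck_suffix:
  assumes "count_list w U = c" "count_list w D = c + l"
    "\<And>p. prefix p w \<Longrightarrow> count_list p D \<le> l + count_list p U" "w = [] \<or> hd w = U"
  shows "queue_path c l w"
  using assms
proof (induction c arbitrary: l w)
  case 0
  then have "w = []" using count_list_U_0 by blast
  with 0 show ?case by (simp add: queue_path.empty)
next
  case (Suc c)
  then obtain v where w: "w = U # v" by (cases w) auto
  show ?case
  proof (cases "v = [] \<or> hd v = U")
    case True
    have "queue_path c (Suc l) v"
    proof (rule Suc.IH)
      fix p assume "prefix p v"
      then show "count_list p D \<le> Suc l + count_list p U"
        using Suc.prems(3)[of "U # p"] by (simp add: w)
    qed (use Suc.prems True w in auto)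
    then show ?thesis unfolding w by (rule queue_path.enqueue)
  next
    case False
    define k where "k = length (takeWhile ((=) D) v) - 1"
    define v' where "v' = dropWhile ((=) D) v"
    have *: "takeWhile ((=) D) v = replicate (Suc k) D"
    proof -
      have "takeWhile ((=) D) v \<noteq> []"
        using False by (cases v) (auto intro: dyck_step.exhaust)
      then have "Suc k = length (takeWhile ((=) D) v)"
        unfolding k_def by simp
      moreover have "\<forall>x \<in> set (takeWhile ((=) D) v). x = D"
        by (metis set_takeWhileD)
      ultimately show ?thesis using replicate_length_same by metis
    qed
    have v: "v = replicate (Suc k) D @ v'"
      unfolding v'_def *[symmetric] by simp
    have v': "v' = [] \<or> hd v' = U"
      using hd_dropWhile[of "(=) D" v] unfolding v'_def
      by (cases "hd (dropWhile ((=) D) v)") auto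
    \<comment> \<open>The prefix condition at the end of the block reads
      \<open>k + 1 \<le> l + 1\<close>: the queue holds enough entries.\<close>
    have "k \<le> l"
      using Suc.prems(3)[of "U # replicate (Suc k) D"] by (auto simp: w v count_list_replicate)
    have "queue_path c (l - k) v'"
    proof (rule Suc.IH)
      fix p assume "prefix p v'"
      then show "count_list p D \<le> (l - k) + count_list p U"
        using Suc.prems(3)[of "U # replicate (Suc k) D @ p"] \<open>k \<le> l\<close>
        by (simp add: w v count_list_append count_list_replicate)
    qed (use Suc.prems v' \<open>k \<le> l\<close> in \<open>auto simp: w v count_list_append count_list_replicate\<close>)
    then show ?thesis
      using queue_path.head[of c "l - k" v' k] \<open>k \<le> l\<close> by (simp add: w v)
  qed
qed

lemma Dyck_paths_eq_queue_path: "Dyck_paths n = {w. queue_path n 0 w}"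
proof (intro set_eqI iffI)
  fix w assume w: "w \<in> Dyck_paths n"
  have "w = [] \<or> hd w = U"
  proof (cases w)
    case (Cons x v)
    then have "prefix [x] w" by simp
    then have "count_list [x] D \<le> count_list [x] U"
      using w unfolding Dyck_paths_def by blast
    then show ?thesis using Cons by (cases x) auto
  qed simp
  with w show "w \<in> {w. queue_path n 0 w}"
    by (auto simp: Dyck_paths_def intro: queue_path_if_Dyck_suffix)
next
  fix w assume "w \<in> {w. queue_path n 0 w}"
  then show "w \<in> Dyck_paths n"
    using Dyck_suffix_if_queue_path[of n 0 w] by (simp add: Dyck_paths_def)
qed

section \<open>Layered runs as outcomes of the queue process\<close>

text \<open>Labels arrive in decreasing order, so the queue stays decreasing. Its initial segments,
  reversed, are increasing and exceed whatever is served later.\<close>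

lemma layered_if_queue_runs:
  assumes "queue_runs c q rs" "sorted_wrt (>) q" "\<forall>x \<in> set q. c < x"
  shows "sorted_wrt layered rs \<and> (\<forall>a \<in> set rs. increasing_run a) \<and>
    distinct (concat rs) \<and> set (concat rs) = {1..c} \<union> set q"
  using assms
proof (induction rule: queue_runs.induct)
  case empty
  then show ?case by simp
next
  case (head c q2 rs q1)
  have q: "sorted_wrt (>) q1" "sorted_wrt (>) q2" "\<forall>x \<in> set q1. \<forall>y \<in> set q2. y < x"
    "\<forall>x \<in> set q1 \<union> set q2. Suc c < x"
    using head.prems by (auto simp: sorted_wrt_append)
  then have "\<forall>x \<in> set q2. c < x" using Suc_lessD by blast
  from head.IH[OF q(2) this] have IH: "sorted_wrt layered rs" "\<forall>a \<in> set rs. increasing_run a"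
    "distinct (concat rs)" "set (concat rs) = {1..c} \<union> set q2"
    by blast+
  have "layered (Suc c # rev q1) b" if "b \<in> set rs" for b
    unfolding layered_def
  proof (intro conjI ballI)
    show "hd b < hd (Suc c # rev q1)"
      using queue_runs_heads_le[OF head.hyps that] by simp
  next
    fix x y assume x: "x \<in> set (tl (Suc c # rev q1))" and "y \<in> set (tl b)"
    then have "y \<in> set b" by (cases b) auto
    then have "y \<in> set (concat rs)" using that by auto
    then have "y \<le> c \<or> y \<in> set q2" unfolding IH(4) by auto
    moreover have "x \<in> set q1" using x by simp
    moreover from this have "Suc c < x" using q(4) by blast
    ultimately show "y < x" using q(3) by auto
  qed
  moreover have "increasing_run (Suc c # rev q1)"
    using q by (simp add: sorted_wrt_rev)
  moreover have "distinct (concat ((Suc c # rev q1) # rs))"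
  proof -
    have "distinct (rev q1)"
      using q(1) by (metis distinct_rev sorted_wrt_rev strict_sorted_iff)
    moreover have "x \<notin> set (concat rs)" if "x \<in> set q1" for x
    proof -
      have "Suc c < x" "x \<notin> set q2" using that q(3,4) by blast+
      then show ?thesis unfolding IH(4) by simp
    qed
    moreover have "Suc c \<notin> set q1 \<union> set (concat rs)"
      using q(4) unfolding IH(4) by auto
    ultimately show ?thesis using IH(3) by auto
  qed
  moreover have "set (concat ((Suc c # rev q1) # rs)) = {1..Suc c} \<union> set (q1 @ q2)"
    using IH(4) by auto
  moreover have "sorted_wrt layered ((Suc c # rev q1) # rs)"
    using \<open>\<And>b. b \<in> set rs \<Longrightarrow> layered (Suc c # rev q1) b\<close> IH(1) by simp
  ultimately show ?case using IH(2) by (intro conjI) simp_all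
next
  case (enqueue c q rs)
  then have "sorted_wrt layered rs \<and> (\<forall>a \<in> set rs. increasing_run a) \<and>
    distinct (concat rs) \<and> set (concat rs) = {1..c} \<union> set (q @ [Suc c])"
    by (simp add: sorted_wrt_append Suc_lessD)
  then show ?case by auto
qed

text \<open>The largest unplaced label either heads the first run or lies in some tail and is
  enqueued. In the first case layering makes the tail of that run the largest entries of the queue,
  hence an initial segment of it.\<close>

lemma queue_runs_if_layered:
  assumes "sorted_wrt layered rs" "\<forall>a \<in> set rs. increasing_run a" "distinct (concat rs)"
    "set (concat rs) = {1..c} \<union> set q" "\<forall>a \<in> set rs. hd a \<le> c"
    "sorted_wrt (>) q" "\<forall>x \<in> set q. c < x"
  shows "queue_runs c q rs"
  using assms
proof (induction c arbitrary: q rs)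
  case 0
  \<comment> \<open>For \<open>c = 0\<close> a head would have to be at most 0, while all entries
    are positive.\<close>
  have "rs = []"
  proof (cases rs)
    case (Cons a rs')
    then have "hd a \<in> set a" using 0(2) hd_in_set by auto
    then have "hd a \<in> set (concat rs)" using Cons by simp
    then have "0 < hd a" using 0(7) unfolding 0(4) by simp
    then show ?thesis using 0 Cons by auto
  qed simp
  with 0 show ?case by (simp add: queue_runs.empty)
next
  case (Suc c)
  have "Suc c \<in> set (concat rs)" using Suc.prems(4) by simp
  then obtain a rs' where rs: "rs = a # rs'" by (cases rs) auto
  then obtain h t where a: "a = h # t" using Suc.prems(2) by (cases a) auto
  show ?case
  proof (cases "h = Suc c")
    case True
    define q2 where "q2 = filter (\<lambda>x. x \<notin> set t) q"
    have t: "sorted_wrt (<) t" "\<forall>x \<in> set t. Suc c < x" "set t \<inter> set (concat rs') = {}"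
      using Suc.prems(2,3) True by (auto simp: rs a)
    have rs_set: "insert h (set t \<union> set (concat rs')) = {1..Suc c} \<union> set q"
      using Suc.prems(4) by (simp add: rs a)
    have tq: "set t \<subseteq> set q"
    proof
      fix x assume "x \<in> set t"
      then have "x \<in> {1..Suc c} \<union> set q" "Suc c < x" using rs_set t(2) by blast+
      then show "x \<in> set q" by simp
    qed
    have "h \<notin> set q" using Suc.prems(7) True by blast
    then have q2: "x \<in> set q2 \<longleftrightarrow> x \<in> set q \<and> x \<in> set (concat rs')" for x
      using rs_set t(3) unfolding q2_def by auto
    have heads: "hd b < Suc c" if "b \<in> set rs'" for b
      using Suc.prems(1) that True by (auto simp: rs a layered_def)
    have less: "y < x" if "x \<in> set t" "y \<in> set (concat rs')" for x y
    proof -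
      obtain b where b: "b \<in> set rs'" "y \<in> set b" using \<open>y \<in> set (concat rs')\<close> by auto
      from b(2) have "y = hd b \<or> y \<in> set (tl b)" by (cases b) auto
      then show ?thesis
      proof
        assume "y = hd b"
        then have "y < Suc c" using heads b(1) by blast
        then show ?thesis using t(2) \<open>x \<in> set t\<close> by force
      next
        assume "y \<in> set (tl b)"
        then show ?thesis using Suc.prems(1) b \<open>x \<in> set t\<close> by (auto simp: rs a layered_def)
      qed
    qed
    have q2_sorted: "sorted_wrt (>) q2"
      unfolding q2_def using Suc.prems(6) by (rule sorted_wrt_filter)
    \<comment> \<open>Both sides, reversed, are strictly increasing with the same set of entries, so
      they coincide.\<close>
    have q: "q = rev t @ q2"
    proof -
      have "sorted_wrt (<) (rev q)" using Suc.prems(6) by (simp add: sorted_wrt_rev)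
      moreover have "sorted_wrt (<) (rev (rev t @ q2))"
        using t q2_sorted less q2 by (auto simp: sorted_wrt_append sorted_wrt_rev)
      moreover have "set (rev q) = set (rev (rev t @ q2))"
        using tq unfolding q2_def by auto
      ultimately have "rev q = rev (rev t @ q2)"
        using strict_sorted_equal by blast
      then show ?thesis by (simp only: rev_is_rev_conv)
    qed
    have "queue_runs c q2 rs'"
    proof (rule Suc.IH)
      show "set (concat rs') = {1..c} \<union> set q2"
      proof (intro set_eqI iffI)
        fix x assume x: "x \<in> set (concat rs')"
        then have "x \<in> {1..Suc c} \<union> set q" "x \<noteq> Suc c"
          using Suc.prems(3,4) True by (auto simp: rs a)
        with x show "x \<in> {1..c} \<union> set q2" by (auto simp: q2)
      next
        fix x assume "x \<in> {1..c} \<union> set q2"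
        then show "x \<in> set (concat rs')"
        proof
          assume x: "x \<in> {1..c}"
          then have "x \<in> set (concat rs)" "x \<noteq> h" "x \<notin> set t"
            using Suc.prems(4) t True by auto
          then show ?thesis by (simp add: rs a)
        qed (simp add: q2)
      qed
      show "\<forall>a \<in> set rs'. hd a \<le> c" using heads by fastforce
      show "\<forall>x \<in> set q2. c < x" using Suc.prems(7) unfolding q2_def by auto
    qed (use Suc.prems q2_sorted in \<open>auto simp: rs\<close>)
    then show ?thesis
      using queue_runs.head[of c q2 rs' "rev t"] True q by (simp add: rs a)
  next
    case False
    have "queue_runs c (q @ [Suc c]) rs"
    proof (rule Suc.IH)
      show "set (concat rs) = {1..c} \<union> set (q @ [Suc c])" using Suc.prems(4) by auto
      \<comment> \<open>The first head is the largest one, so \<open>h \<noteq> Suc c\<close> bounds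
        all heads by \<open>c\<close>.\<close>
      have "hd b \<le> h" if "b \<in> set rs" for b
        using Suc.prems(1) that by (auto simp: rs a layered_def)
      moreover have "h \<le> c" using Suc.prems(5) False by (auto simp: rs a)
      ultimately show "\<forall>a \<in> set rs. hd a \<le> c" by force
      show "sorted_wrt (>) (q @ [Suc c])" using Suc.prems(6,7) by (simp add: sorted_wrt_append)
      show "\<forall>x \<in> set (q @ [Suc c]). c < x" using Suc.prems(7) by auto
    qed (use Suc.prems in auto)
    then show ?thesis by (rule queue_runs.enqueue)
  qed
qed

lemma ascending_runs_Sort_SC132:
  "bij_betw ascending_runs (Sort_SC132 n) {rs. queue_runs n [] rs}"
proof (rule bij_betw_byWitness[where f' = concat])
  show "\<forall>\<pi> \<in> Sort_SC132 n. concat (ascending_runs \<pi>) = \<pi>"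
    by (simp add: concat_ascending_runs)
  show "\<forall>rs \<in> {rs. queue_runs n [] rs}. ascending_runs (concat rs) = rs"
    using layered_if_queue_runs ascending_runs_concat_layered by fastforce
  show "ascending_runs ` Sort_SC132 n \<subseteq> {rs. queue_runs n [] rs}"
  proof (clarsimp)
    fix \<pi> assume "\<pi> \<in> Sort_SC132 n"
    then have \<pi>: "distinct \<pi>" "set \<pi> = {1..n}" "avoids_classically [2, 3, 1] (SC132 \<pi>)"
      unfolding Sort_SC132_def permutations_of_set_def by auto
    note inc = increasing_run_ascending_runs[of \<pi>]
    show "queue_runs n [] (ascending_runs \<pi>)"
    proof (rule queue_runs_if_layered)
      show "sorted_wrt layered (ascending_runs \<pi>)"
        using \<pi> SC132_avoids_231_iff_layered by blast
      have "hd a \<in> {1..n}" if "a \<in> set (ascending_runs \<pi>)" for a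
        using that inc \<pi>(2) concat_ascending_runs[of \<pi>] by (metis UN_I hd_in_set set_concat)
      then show "\<forall>a \<in> set (ascending_runs \<pi>). hd a \<le> n" by auto
    qed (use \<pi> inc in \<open>auto simp only: concat_ascending_runs\<close>, auto)
  qed
  show "concat ` {rs. queue_runs n [] rs} \<subseteq> Sort_SC132 n"
  proof (clarsimp simp del: set_concat)
    fix rs assume "queue_runs n [] rs"
    then have rs: "sorted_wrt layered rs" "\<forall>a \<in> set rs. increasing_run a"
      "distinct (concat rs)" "set (concat rs) = {1..n}"
      using layered_if_queue_runs[of n "[]" rs] by auto
    then have "ascending_runs (concat rs) = rs"
      using ascending_runs_concat_layered by blast
    then show "concat rs \<in> Sort_SC132 n"
      using rs SC132_avoids_231_iff_layered[of "concat rs"]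
      unfolding Sort_SC132_def permutations_of_set_def by simp
  qed
qed

lemma Phi_word_bij:
  "bij_betw (Phi_word (n + 1)) {rs. queue_runs n [] rs} (Dyck_paths n)"
  unfolding bij_betw_def Dyck_paths_eq_queue_path
proof (intro conjI inj_onI set_eqI iffI)
  fix w assume "w \<in> Phi_word (n + 1) ` {rs. queue_runs n [] rs}"
  then show "w \<in> {w. queue_path n 0 w}"
    using queue_path_Phi_word[of n "[]"] by auto
next
  fix w assume "w \<in> {w. queue_path n 0 w}"
  then show "w \<in> Phi_word (n + 1) ` {rs. queue_runs n [] rs}"
    using Phi_word_surj[of n 0 w "[]"] by auto
qed (use Phi_word_inj in auto)

subsection \<open>Counting Dyck paths\<close>

text \<open>Separate counts keep the family closed under deleting the last letter;
  \<open>a = b = n\<close> gives \<open>Dyck_paths n\<close>.\<close>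

definition ballot_words :: "nat \<Rightarrow> nat \<Rightarrow> dyck_step list set" where
  "ballot_words a b = {w. count_list w U = a \<and> count_list w D = b \<and>
     (\<forall>p. prefix p w \<longrightarrow> count_list p D \<le> count_list p U)}"

lemma snoc_in_ballot_words_iff:
  "w @ [U] \<in> ballot_words a b \<longleftrightarrow> a > 0 \<and> w \<in> ballot_words (a - 1) b"
  "w @ [D] \<in> ballot_words a b \<longleftrightarrow> b > 0 \<and> b \<le> a \<and> w \<in> ballot_words a (b - 1)"
  unfolding ballot_words_def by (auto simp: count_list_append)

lemma count_list_U_D: "count_list w U + count_list w D = length w"
proof (induction w)
  case (Cons x w)
  then show ?case by (cases x) auto
qed simp

lemma finite_ballot_words: "finite (ballot_words a b)"
proof (rule finite_subset)
  have "set w \<subseteq> {U, D}" for w using dyck_step.exhaust by auto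
  then show "ballot_words a b \<subseteq> {w. set w \<subseteq> {U, D} \<and> length w = a + b}"
    using count_list_U_D unfolding ballot_words_def by force
  show "finite {w. set w \<subseteq> {U, D} \<and> length w = a + b}"
    by (rule finite_lists_length_eq) simp
qed

lemma ballot_words_0: "ballot_words a 0 = {replicate a U}"
proof (intro set_eqI iffI)
  fix w assume "w \<in> ballot_words a 0"
  then have "count_list w D = 0" "length w = a"
    using count_list_U_D[of w] by (auto simp: ballot_words_def)
  then have "\<forall>x \<in> set w. x = U"
    by (metis count_list_0_iff dyck_step.exhaust)
  then show "w \<in> {replicate a U}"
    using \<open>length w = a\<close> replicate_length_same by fastforce
next
  fix w assume "w \<in> {replicate a U}"
  moreover have "count_list p D = 0" if "prefix p (replicate a U)" for p
    using set_mono_prefix[OF that] by (auto simp: count_list_0_iff split: if_splits)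
  ultimately show "w \<in> ballot_words a 0"
    by (auto simp: ballot_words_def count_list_replicate)
qed

lemma ballot_words_empty: "a < b \<Longrightarrow> ballot_words a b = {}"
  unfolding ballot_words_def by force

lemma ballot_words_Suc:
  assumes "b \<le> a"
  shows "ballot_words (Suc a) (Suc b) =
    (\<lambda>w. w @ [U]) ` ballot_words a (Suc b) \<union> (\<lambda>w. w @ [D]) ` ballot_words (Suc a) b"
proof (intro set_eqI iffI)
  fix w assume w: "w \<in> ballot_words (Suc a) (Suc b)"
  then have "w \<noteq> []" by (auto simp: ballot_words_def)
  then obtain v x where "w = v @ [x]" by (metis rev_exhaust)
  then show "w \<in> (\<lambda>w. w @ [U]) ` ballot_words a (Suc b) \<union> (\<lambda>w. w @ [D]) ` ballot_words (Suc a) b"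
    using w by (cases x) (auto simp: snoc_in_ballot_words_iff)
qed (use assms in \<open>auto simp: snoc_in_ballot_words_iff\<close>)

lemma card_ballot_words_Suc:
  assumes "b \<le> a"
  shows "card (ballot_words (Suc a) (Suc b)) =
    card (ballot_words a (Suc b)) + card (ballot_words (Suc a) b)"
  unfolding ballot_words_Suc[OF assms]
  by (subst card_Un_disjoint) (auto simp: finite_ballot_words card_image inj_on_def)

text \<open>The ballot formula, by the recursion on the last letter. The boundary
  \<open>b = a + 1\<close>, where both sides vanish, is included because the recursion reaches it
  from \<open>b = a\<close>.\<close>

lemma card_ballot_words:
  "b \<le> a + 1 \<Longrightarrow>
    real (card (ballot_words a b)) = (real a + 1 - real b) / (real a + 1) * real ((a + b) choose b)"
proof (induction "a + b" arbitrary: a b)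
  case 0
  then show ?case by (simp add: ballot_words_0)
next
  case (Suc m)
  consider "b = 0" | "b = a + 1" | a' b' where "a = Suc a'" "b = Suc b'" "b' \<le> a'"
    using Suc.prems by (cases a; cases b) force+
  then show ?case
  proof cases
    case 3
    define X where "X = real ((a' + b' + 1) choose b')"
    define Y where "Y = real ((a' + b' + 1) choose Suc b')"
    have IH1: "real (card (ballot_words a' (Suc b'))) = (real a' - real b') / (real a' + 1) * Y"
      using Suc(1)[of a' "Suc b'"] Suc(2) 3 by (simp add: Y_def)
    have IH2: "real (card (ballot_words (Suc a') b')) = (real a' + 2 - real b') / (real a' + 2) * X"
      using Suc(1)[of "Suc a'" b'] Suc(2) 3 by (simp add: X_def add_ac)
    \<comment> \<open>The ratio of neighbouring binomial coefficients eliminates \<open>Y\<close>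
      and leaves a rational identity in \<open>a'\<close> and \<open>b'\<close>, times
      \<open>X\<close>.\<close>
    have XY: "(real b' + 1) * Y = (real a' + 1) * X"
    proof -
      have "Suc b' * ((a' + b' + 1) choose Suc b') = (a' + 1) * ((a' + b' + 1) choose b')"
        using binomial_absorb_comp[of "a' + b' + 1" b'] binomial_absorption[of b' "a' + b' + 1"]
        by simp
      then show ?thesis unfolding X_def Y_def
        by (metis of_nat_Suc of_nat_add of_nat_mult of_nat_1 add.commute)
    qed
    have "((a + b) choose b) = ((a' + b' + 1) choose b') + ((a' + b' + 1) choose Suc b')"
      by (simp add: 3)
    then have choose: "real ((a + b) choose b) = X + Y" by (simp add: X_def Y_def)
    have Y: "Y = (real a' + 1) * X / (real b' + 1)" using XY by (simp add: field_simps)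
    have "real (card (ballot_words a b)) =
        (real a' - real b') / (real a' + 1) * Y + (real a' + 2 - real b') / (real a' + 2) * X"
      using card_ballot_words_Suc[OF 3(3)] IH1 IH2 3 by simp
    also have "\<dots> = (real a' + 1 - real b') / (real a' + 2) * (X + Y)"
      unfolding Y by (simp add: divide_simps) (simp add: algebra_simps)
    finally show ?thesis unfolding choose by (simp add: 3 add_ac)
  qed (simp_all add: ballot_words_0 ballot_words_empty)
qed

theorem theorem4p4:
  fixes n :: nat
  assumes "n \<ge> 1"
  shows "(\<forall>\<pi> \<in> Sort_SC132 n. Phi_exponents_nonneg n \<pi>) \<and>
    bij_betw (Phi n) (Sort_SC132 n) (Dyck_paths n) \<and>
    real (card (Sort_SC132 n)) = 1 / (real n + 1) * real ((2 * n) choose n)"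
proof (intro conjI ballI)
  fix \<pi> assume "\<pi> \<in> Sort_SC132 n"
  then have runs: "queue_runs n [] (ascending_runs \<pi>)"
    using ascending_runs_Sort_SC132 bij_betwE by blast
  then have "sorted_wrt (\<ge>) (map hd (ascending_runs \<pi>))"
    unfolding sorted_wrt_map
    using layered_if_queue_runs[OF runs] by (auto simp: layered_def intro: sorted_wrt_mono_rel[rotated])
  moreover have "\<forall>x \<in> set (map hd (ascending_runs \<pi>)). x \<le> n + 1"
    using queue_runs_heads_le[OF runs] by force
  ultimately have "sorted_wrt (\<ge>) ((n + 1) # map hd (ascending_runs \<pi>))" by simp
  then show "Phi_exponents_nonneg n \<pi>"
    unfolding Phi_exponents_nonneg_def by (rule successively_if_sorted_wrt)
next
  have Phi: "Phi n = Phi_word (n + 1) \<circ> ascending_runs" by (auto simp: Phi_def)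
  show bij: "bij_betw (Phi n) (Sort_SC132 n) (Dyck_paths n)"
    unfolding Phi using ascending_runs_Sort_SC132 Phi_word_bij by (rule bij_betw_trans)
  have "card (Sort_SC132 n) = card (ballot_words n n)"
    using bij_betw_same_card[OF bij] by (simp add: Dyck_paths_def ballot_words_def)
  then show "real (card (Sort_SC132 n)) = 1 / (real n + 1) * real ((2 * n) choose n)"
    using card_ballot_words[of n n] by (simp add: mult_2)
qed

end
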